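(* Let $\mathcal{L}_1,\mathcal{L}_2\subset\mathbb{R}^n$ be $n$-dimensional (full-rank) lattices. Let $B_1,B_2\in\mathbb{R}^{n\times n}$ be bases of $\mathcal{L}_1,\mathcal{L}_2$ respectively, whose columns are sorted in non-decreasing order of Euclidean length. Then \[ M(\mathcal{L}_1,\mathcal{L}_2)\,M(\mathcal{L}_2,\mathcal{L}_1)\le \kappa(B_2B_1^{-1})\le n^2 S(B_1)^2S(B_2)^2\cdot M(\mathcal{L}_1,\mathcal{L}_2)\,M(\mathcal{L}_2,\mathcal{L}_1). \] In particular, \[ M(\mathcal{L}_1,\mathcal{L}_2)\,M(\mathcal{L}_2,\mathcal{L}_1)\le \mathrm{dist}(\mathcal{L}_1,\mathcal{L}_2)\le n^2 S(\mathcal{L}_1)^2S(\mathcal{L}_2)^2\cdot M(\mathcal{L}_1,\mathcal{L}_2)\,M(\mathcal{L}_2,\mathcal{L}_1). \]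
   Context: A basis $B=[b_1,\dots,b_n]$ of a full-rank lattice $\mathcal{L}\subset\mathbb{R}^n$ is a matrix whose columns are linearly independent and generate $\mathcal{L}$ over $\mathbb{Z}$. Its dual basis is $B^*=B^{-T}=[b_1^*,\dots,b_n^*]$. Seysen's condition number is $S(B)=\max_{i\in[n]}\|b_i\|\,\|b_i^*\|$, and $S(\mathcal{L})$ is the minimum of $S(B)$ over all bases $B$ of $\mathcal{L}$. The $i$-th successive minimum $\lambda_i(\mathcal{L})$ is the least $r>0$ such that $\mathcal{L}$ contains $i$ linearly independent vectors of norm at most $r$; $M(\mathcal{L}_1,\mathcal{L}_2)=\max_{i\in[n]}\lambda_i(\mathcal{L}_2)/\lambda_i(\mathcal{L}_1)$. For invertible $T$, $\kappa(T)=\|T\|\,\|T^{-1}\|$ with $\|\cdot\|$ the operator norm, and $\mathrm{dist}(\mathcal{L}_1,\mathcal{L}_2)=\min\{\kappa(T): T\text{ linear},\ T(\mathcal{L}_1)=\mathcal{L}_2\}$. All norms are Euclidean. *)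

theory Defs
  imports "HOL-Analysis.Analysis"
begin

text \<open>Injectivity of the column map is stated separately because the set of columns of a
  matrix with repeated columns may still be linearly independent.\<close>

definition lattice_basis :: "real ^ 'n ^ 'n \<Rightarrow> (real ^ 'n) set \<Rightarrow> bool" where
  "lattice_basis B L \<longleftrightarrow>
     inj (\<lambda>i. column i B) \<and> independent (columns B) \<and>
     L = range (\<lambda>z :: 'n \<Rightarrow> int. \<Sum>i\<in>UNIV. of_int (z i) *\<^sub>R column i B)"

definition full_rank_lattice :: "(real ^ 'n) set \<Rightarrow> bool" where
  "full_rank_lattice L \<longleftrightarrow> (\<exists>B. lattice_basis B L)"

definition dual_basis :: "real ^ 'n ^ 'n \<Rightarrow> real ^ 'n ^ 'n" where
  "dual_basis B = transpose (matrix_inv B)"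

definition seysen :: "real ^ 'n ^ 'n \<Rightarrow> real" where
  "seysen B = (MAX i. norm (column i B) * norm (column i (dual_basis B)))"

text \<open>The minima below are expressed with \<open>LEAST\<close> on the reals, which denotes the actual minimum
  of a set. They are attained for full-rank lattices, since a ball contains only finitely many
  lattice points.\<close>

definition lattice_seysen :: "(real ^ 'n) set \<Rightarrow> real" where
  "lattice_seysen L = (LEAST s. \<exists>B. lattice_basis B L \<and> s = seysen B)"

definition succ_min :: "nat \<Rightarrow> (real ^ 'n) set \<Rightarrow> real" where
  "succ_min i L =
     (LEAST r. r > 0 \<and> (\<exists>V \<subseteq> L. independent V \<and> card V = i \<and> (\<forall>v\<in>V. norm v \<le> r)))"

definition succ_min_ratio :: "(real ^ 'n) set \<Rightarrow> (real ^ 'n) set \<Rightarrow> real" where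
  "succ_min_ratio L1 L2 = (MAX i\<in>{1..CARD('n)}. succ_min i L2 / succ_min i L1)"

definition cond_num :: "(real ^ 'n \<Rightarrow> real ^ 'n) \<Rightarrow> real" where
  "cond_num T = onorm T * onorm (inv T)"

text \<open>A linear map carrying one full-rank lattice onto another is automatically bijective, so
  \<^const>\<open>inv\<close> in \<^const>\<open>cond_num\<close> is the genuine inverse.\<close>

definition lattice_dist :: "(real ^ 'n) set \<Rightarrow> (real ^ 'n) set \<Rightarrow> real" where
  "lattice_dist L1 L2 = (LEAST k. \<exists>T. linear T \<and> T ` L1 = L2 \<and> k = cond_num T)"

text \<open>The linear order on the index type is the order of the columns.\<close>

definition sorted_columns :: "real ^ 'n::{finite,linorder} ^ 'n::{finite,linorder} \<Rightarrow> bool" where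
  "sorted_columns B \<longleftrightarrow> mono (\<lambda>i. norm (column i B))"

end

theory Submission
  imports Defs
begin

text \<open>A linear map \<open>T\<close> with \<open>T ` L\<^sub>1 = L\<^sub>2\<close> stretches independent lattice vectors by at most
  \<open>\<parallel>T\<parallel>\<close>, so \<open>\<lambda>\<^sub>i(L\<^sub>2) \<le> \<parallel>T\<parallel> \<lambda>\<^sub>i(L\<^sub>1)\<close>; with the same bound for the inverse this is the lower
  bound. For sorted bases, \<open>\<lambda>\<^sub>i(L) \<le> \<parallel>b\<^sub>i\<parallel> \<le> S(B) \<lambda>\<^sub>i(L)\<close>, because nonzero pairings of lattice vectors
  with dual basis vectors are at least 1 in absolute value. Since the base change is the sum of the
  rank-one maps \<open>x \<mapsto> (d\<^sub>i \<bullet> x) b\<^sub>i\<close> with \<open>d\<^sub>i\<close> dual to the first basis and \<open>b\<^sub>i\<close> in the second,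
  its norm is at most \<open>n S(B\<^sub>1) S(B\<^sub>2) M(L\<^sub>1, L\<^sub>2)\<close>.
  All minima are attained: bounding \<open>S(B)\<close> or \<open>\<kappa>(T)\<close> bounds the basis vectors or their images,
  and a ball contains finitely many lattice points.\<close>

section \<open>Attained minima and sorting permutations\<close>

text \<open>On the reals \<open>LEAST\<close> need not denote a member of the set. It does once the
  part below some member \<open>a\<close> is finite: the minimum of that part bounds everything
  else. Discreteness of lattices supplies the finiteness in each use.\<close>

lemma Least_attained_if_finite_below:
  fixes P :: "real \<Rightarrow> bool"
  assumes "P a" and fin: "finite {x. P x \<and> x \<le> a}"
  shows "P (Least P)" and "P y \<Longrightarrow> Least P \<le> y"
proof -
  let ?S = "{x. P x \<and> x \<le> a}"
  define m where "m = Min ?S"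
  have ne: "?S \<noteq> {}" using assms by auto
  have m: "P m" "m \<le> a" using Min_in[OF fin ne] by (auto simp: m_def)
  have le: "m \<le> z" if "P z" for z
  proof (cases "z \<le> a")
    case True
    then show ?thesis using that fin by (auto simp: m_def)
  next
    case False
    then show ?thesis using m by linarith
  qed
  have "Least P = m" by (rule Least_equality) (use m le in auto)
  then show "P (Least P)" "P y \<Longrightarrow> Least P \<le> y" using m le by auto
qed

text \<open>Needed to pass from an arbitrary minimising basis to a sorted one, since the norm
  estimates below require sorted columns.\<close>

lemma ex_sorting_permutation:
  fixes f :: "'n::{finite,linorder} \<Rightarrow> real"
  shows "\<exists>p :: 'n \<Rightarrow> 'n. bij p \<and> mono (\<lambda>i. f (p i))"
proof -
  define ys where "ys = sort_key f (sorted_list_of_set (UNIV :: 'n set))"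
  have ys: "sorted (map f ys)" "distinct ys" "length ys = CARD('n)"
    by (simp_all add: ys_def)
  \<comment> \<open>\<open>r i\<close> is the zero-based position of \<open>i\<close> in the index
    order, so it serves as a list index into \<open>ys\<close>.\<close>
  define r where "r i = card {..<i}" for i :: 'n
  have less: "r i < r j" if "i < j" for i j
    unfolding r_def using that by (intro psubset_card_mono) auto
  have rlt: "r i < CARD('n)" for i
    unfolding r_def by (intro psubset_card_mono) auto
  have "inj r"
    by (metis (no_types) injI less less_irrefl linorder_neq_iff)
  then have "inj (\<lambda>i. ys ! r i)"
    using ys rlt by (auto simp: inj_def nth_eq_iff_index_eq)
  then have "bij (\<lambda>i. ys ! r i)"
    by (simp add: bij_def finite_UNIV_inj_surj)
  moreover have "mono (\<lambda>i. f (ys ! r i))"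
  proof (rule monoI)
    fix i j :: 'n assume "i \<le> j"
    then have "r i \<le> r j" using less by (metis le_less)
    then show "f (ys ! r i) \<le> f (ys ! r j)"
      using sorted_nth_mono[OF ys(1), of "r i" "r j"] rlt[of i] rlt[of j] ys(3) by simp
  qed
  ultimately show ?thesis by blast
qed

section \<open>Dual bases\<close>

lemma lattice_basis_invertible:
  assumes "lattice_basis B L"
  shows "invertible B"
proof -
  have "x = 0" if "B *v x = 0" for x
  proof -
    have inj: "inj (\<lambda>i. column i B)" and ind: "independent (columns B)"
      using assms by (auto simp: lattice_basis_def)
    have cols: "columns B = range (\<lambda>i. column i B)" by (auto simp: columns_def)
    \<comment> \<open>Independence concerns coefficients attached to elements of the set of columns;
      injectivity of the column map lets each coordinate of \<open>x\<close> be attached to its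
      column.\<close>
    define u where "u v = x $ (inv (\<lambda>i. column i B) v)" for v
    have u: "u (column i B) = x $ i" for i
      using inv_f_f[OF inj, of i] by (simp add: u_def)
    have "(\<Sum>v\<in>columns B. u v *\<^sub>R v) = (\<Sum>i\<in>UNIV. x $ i *\<^sub>R column i B)"
      unfolding cols by (subst sum.reindex[OF inj]) (simp add: u)
    also have "\<dots> = B *v x" by (simp add: matrix_mult_sum scalar_mult_eq_scaleR)
    finally have "(\<Sum>v\<in>columns B. u v *\<^sub>R v) = 0" using that by simp
    then have "\<forall>v\<in>columns B. u v = 0"
      using ind by (auto simp: independent_explicit)
    then have "x $ i = 0" for i using u[of i] by (auto simp: cols)
    then show "x = 0" by (simp add: vec_eq_iff)
  qed
  then show ?thesis
    using matrix_left_invertible_ker invertible_left_inverse by blast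
qed

lemma matrix_inv_mult_left: "invertible A \<Longrightarrow> matrix_inv A ** A = mat 1"
  and matrix_inv_mult_right: "invertible A \<Longrightarrow> A ** matrix_inv A = mat 1"
  for A :: "real ^ 'n ^ 'n"
  unfolding matrix_inv_def invertible_def by (metis (mono_tags, lifting) someI_ex)+

lemma matrix_inv_eqI:
  fixes A C :: "real ^ 'n ^ 'n"
  assumes "A ** C = mat 1"
  shows "matrix_inv A = C"
proof -
  have "invertible A" using assms invertible_right_inverse by blast
  then have "matrix_inv A ** (A ** C) = C"
    by (simp add: matrix_mul_assoc matrix_inv_mult_left)
  then show ?thesis using assms by simp
qed

lemma column_dual_basis: "column i (dual_basis B) = row i (matrix_inv B)"
  by (simp add: dual_basis_def)

lemma matrix_inv_vector_nth:
  "(matrix_inv B *v x) $ i = column i (dual_basis B) \<bullet> x"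
  by (simp add: column_dual_basis matrix_vector_mult_def inner_vec_def row_def)

lemma dual_basis_inner:
  assumes "invertible B"
  shows "column i (dual_basis B) \<bullet> column j B = (if i = j then 1 else 0)"
proof -
  have "column i (dual_basis B) \<bullet> column j B = (matrix_inv B ** B) $ i $ j"
    unfolding column_dual_basis
    by (simp add: matrix_matrix_mult_def inner_vec_def row_def column_def)
  then show ?thesis using assms by (simp add: matrix_inv_mult_left mat_def)
qed

lemma dual_basis_expansion:
  assumes "invertible B"
  shows "x = (\<Sum>i\<in>UNIV. (column i (dual_basis B) \<bullet> x) *\<^sub>R column i B)"
proof -
  have "x = B *v (matrix_inv B *v x)"
    using assms by (simp add: matrix_vector_mul_assoc matrix_inv_mult_right)
  also have "\<dots> = (\<Sum>i\<in>UNIV. (column i (dual_basis B) \<bullet> x) *\<^sub>R column i B)"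
    by (subst matrix_mult_sum) (simp only: scalar_mult_eq_scaleR matrix_inv_vector_nth)
  finally show ?thesis .
qed

lemma base_change_expansion:
  "(B2 ** matrix_inv B1) *v x = (\<Sum>i\<in>UNIV. (column i (dual_basis B1) \<bullet> x) *\<^sub>R column i B2)"
  unfolding matrix_vector_mul_assoc[symmetric]
  by (subst matrix_mult_sum) (simp only: scalar_mult_eq_scaleR matrix_inv_vector_nth)

section \<open>Discreteness of lattices\<close>

context
  fixes B :: "real ^ 'n ^ 'n" and L
  assumes B: "lattice_basis B L"
begin

lemma lattice_basis_column_mem: "column j B \<in> L"
proof -
  have "column j B = (\<Sum>i\<in>UNIV. of_int (if i = j then 1 else 0 :: int) *\<^sub>R column i B)"
    by (simp add: if_distrib[of "\<lambda>c. c *\<^sub>R _"] if_distrib[of of_int] cong: if_cong)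
  moreover have "L = range (\<lambda>z :: 'n \<Rightarrow> int. \<Sum>i\<in>UNIV. of_int (z i) *\<^sub>R column i B)"
    using B by (simp add: lattice_basis_def)
  ultimately show ?thesis by (simp only:) (rule rangeI[of _ "\<lambda>i. if i = j then 1 else 0"])
qed

lemma lattice_basis_columns_subset: "columns B \<subseteq> L"
  using lattice_basis_column_mem by (auto simp: columns_def)

text \<open>By biorthogonality the pairing reads off the \<open>j\<close>-th integer
  coefficient.\<close>

lemma dual_basis_inner_Ints:
  assumes "x \<in> L"
  shows "column j (dual_basis B) \<bullet> x \<in> \<int>"
proof -
  obtain z :: "'n \<Rightarrow> int" where "x = (\<Sum>i\<in>UNIV. of_int (z i) *\<^sub>R column i B)"
    using assms B by (auto simp: lattice_basis_def)
  then have "column j (dual_basis B) \<bullet> x = of_int (z j)"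
    by (simp add: inner_sum_right dual_basis_inner[OF lattice_basis_invertible[OF B]]
        if_distrib cong: if_cong)
  then show ?thesis by simp
qed

text \<open>A nonzero integer has absolute value at least 1, and Cauchy-Schwarz bounds the pairing
  from above. All length estimates against a dual basis come from this.\<close>

lemma dual_basis_norm_mult_ge_1:
  assumes "x \<in> L" "column j (dual_basis B) \<bullet> x \<noteq> 0"
  shows "1 \<le> norm (column j (dual_basis B)) * norm x"
  using Ints_nonzero_abs_ge1[OF dual_basis_inner_Ints[OF assms(1)] assms(2)]
    Cauchy_Schwarz_ineq2[of "column j (dual_basis B)" x] by linarith

lemma column_norm_pos: "norm (column i B) > 0"
  using dual_basis_inner[OF lattice_basis_invertible[OF B], of i i] by auto

lemma dual_column_norm_pos: "norm (column i (dual_basis B)) > 0"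
  using dual_basis_inner[OF lattice_basis_invertible[OF B], of i i] by auto

text \<open>A nonzero vector pairs nontrivially with some dual vector, for otherwise its expansion
  would vanish. So its length is at least the reciprocal of any common bound on the dual
  lengths.\<close>

lemma lattice_nonzero_norm_ge: "\<exists>\<delta>>0. \<forall>x\<in>L. x \<noteq> 0 \<longrightarrow> \<delta> \<le> norm x"
proof -
  define D where "D = (\<Sum>i\<in>UNIV. norm (column i (dual_basis B)))"
  have D: "norm (column i (dual_basis B)) \<le> D" for i
    unfolding D_def by (rule member_le_sum) auto
  have "D > 0" using D dual_column_norm_pos by (meson less_le_trans)
  moreover have "1 / D \<le> norm x" if "x \<in> L" "x \<noteq> 0" for x
  proof -
    obtain i where "column i (dual_basis B) \<bullet> x \<noteq> 0"
      using dual_basis_expansion[OF lattice_basis_invertible[OF B], of x] \<open>x \<noteq> 0\<close>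
      by (metis (no_types, lifting) scaleR_zero_left sum.neutral)
    then have "1 \<le> norm (column i (dual_basis B)) * norm x"
      using dual_basis_norm_mult_ge_1 that by blast
    also have "\<dots> \<le> D * norm x" by (intro mult_right_mono D) auto
    finally show ?thesis using \<open>D > 0\<close> by (simp add: field_simps)
  qed
  ultimately show ?thesis by (intro exI[of _ "1 / D"]) auto
qed

text \<open>The coordinates of such a vector are its pairings with the dual basis, hence integers
  bounded by \<open>D * R\<close>, and only finitely many coordinate vectors remain.\<close>

lemma finite_lattice_norm_le: "finite {x \<in> L. norm x \<le> R}"
proof -
  define D where "D = (\<Sum>i\<in>UNIV. norm (column i (dual_basis B)))"
  have D: "norm (column i (dual_basis B)) \<le> D" for i
    unfolding D_def by (rule member_le_sum) auto
  let ?Z = "{k \<in> \<int>. \<bar>k\<bar> \<le> D * R} :: real set"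
  let ?g = "\<lambda>c. \<Sum>i\<in>UNIV. (c i :: real) *\<^sub>R column i B"
  have "{x \<in> L. norm x \<le> R} \<subseteq> ?g ` (PiE UNIV (\<lambda>_. ?Z))"
  proof safe
    fix x assume x: "x \<in> L" "norm x \<le> R"
    have "\<bar>column i (dual_basis B) \<bullet> x\<bar> \<le> D * R" for i
    proof -
      have "\<bar>column i (dual_basis B) \<bullet> x\<bar> \<le> norm (column i (dual_basis B)) * norm x"
        by (rule Cauchy_Schwarz_ineq2)
      also have "\<dots> \<le> D * R"
        using D x(2) by (intro mult_mono) (auto intro: order_trans[OF norm_ge_zero D])
      finally show ?thesis .
    qed
    then show "x \<in> ?g ` (PiE UNIV (\<lambda>_. ?Z))"
      using dual_basis_expansion[OF lattice_basis_invertible[OF B], of x]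
        dual_basis_inner_Ints[OF x(1)]
      by (intro image_eqI[of _ _ "\<lambda>i. column i (dual_basis B) \<bullet> x"]) auto
  qed
  moreover have "finite (PiE (UNIV :: 'n set) (\<lambda>_. ?Z))"
    by (intro finite_PiE) (auto simp: finite_abs_int_segment)
  ultimately show ?thesis by (meson finite_imageI finite_subset)
qed

end

section \<open>Successive minima\<close>

lemma succ_min_attained:
  fixes L :: "(real ^ 'n) set"
  assumes "full_rank_lattice L" "1 \<le> i" "i \<le> CARD('n)"
  shows "succ_min i L > 0"
    and "\<exists>V \<subseteq> L. independent V \<and> card V = i \<and> (\<forall>v\<in>V. norm v \<le> succ_min i L)"
    and "\<And>V r. V \<subseteq> L \<Longrightarrow> independent V \<Longrightarrow> card V = i \<Longrightarrow> (\<And>v. v \<in> V \<Longrightarrow> norm v \<le> r)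
           \<Longrightarrow> succ_min i L \<le> r"
proof -
  define Q where "Q r \<longleftrightarrow> (\<exists>V \<subseteq> L. independent V \<and> card V = i \<and> (\<forall>v\<in>V. norm v \<le> r))" for r
  \<comment> \<open>\<open>Q\<close> is closed upwards, so infinitely many radii may satisfy it
    below a given one. Restricting to norms of lattice vectors leaves finitely many.\<close>
  define P where "P r \<longleftrightarrow> Q r \<and> r \<in> norm ` L" for r
  obtain B where B: "lattice_basis B L"
    using assms(1) by (auto simp: full_rank_lattice_def)
  \<comment> \<open>The length of the longest vector of the family is an admissible radius. It is
    positive because an independent set omits 0, so the minimum of \<open>P\<close> is also the
    least positive radius satisfying \<open>Q\<close>.\<close>
  have shrink: "\<exists>s. P s \<and> 0 < s \<and> s \<le> r" if r: "Q r" for r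
  proof -
    obtain V where V: "V \<subseteq> L" "independent V" "card V = i" "\<forall>v\<in>V. norm v \<le> r"
      using r unfolding Q_def by blast
    have fin: "finite V" "V \<noteq> {}"
      using V(3) assms(2) card_ge_0_finite[of V] by auto
    define s where "s = Max (norm ` V)"
    have "s \<in> norm ` V" unfolding s_def using fin by (intro Max_in) auto
    then obtain w where w: "w \<in> V" "s = norm w" by blast
    have "w \<noteq> 0" using w V(2) dependent_zero by blast
    moreover have "\<forall>v\<in>V. norm v \<le> s" unfolding s_def using fin by auto
    ultimately show ?thesis
      using w V by (intro exI[of _ s]) (auto simp: P_def Q_def)
  qed
  have card_cols: "card (columns B) = CARD('n)"
  proof -
    have "columns B = range (\<lambda>i. column i B)" by (auto simp: columns_def)
    then show ?thesis using B by (simp add: lattice_basis_def card_image)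
  qed
  then obtain V where V: "V \<subseteq> columns B" "card V = i"
    using assms(3) obtain_subset_with_card_n by metis
  have "Q (\<Sum>v\<in>V. norm v)"
    unfolding Q_def
  proof (intro exI[of _ V] conjI ballI)
    show "V \<subseteq> L" using V lattice_basis_columns_subset[OF B] by blast
    show "independent V" using V B independent_mono by (auto simp: lattice_basis_def)
    show "norm v \<le> (\<Sum>v\<in>V. norm v)" if "v \<in> V" for v
      using that V assms(2) card_ge_0_finite[of V] by (intro member_le_sum) auto
  qed (use V in auto)
  then obtain a where a: "P a" using shrink by blast
  have "finite {x. P x \<and> x \<le> a}"
    by (rule finite_subset[OF _ finite_imageI[OF finite_lattice_norm_le[OF B, of a], of norm]])
      (auto simp: P_def)
  note m = Least_attained_if_finite_below[of P, OF a this]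
  have "0 < Least P" "Q (Least P)"
    using shrink[of "Least P"] m by (force simp: P_def)+
  moreover have le: "Least P \<le> r" if "Q r" for r
    using shrink[OF that] m(2) order_trans by blast
  ultimately have eq: "succ_min i L = Least P"
    unfolding succ_min_def Q_def[symmetric] by (intro Least_equality) auto
  show "succ_min i L > 0" using eq \<open>0 < Least P\<close> by simp
  show "\<exists>V \<subseteq> L. independent V \<and> card V = i \<and> (\<forall>v\<in>V. norm v \<le> succ_min i L)"
    using \<open>Q (Least P)\<close> eq by (simp add: Q_def)
  show "succ_min i L \<le> r"
    if "V \<subseteq> L" "independent V" "card V = i" "\<And>v. v \<in> V \<Longrightarrow> norm v \<le> r" for V r
    unfolding eq by (rule le) (use that in \<open>auto simp: Q_def\<close>)
qed

lemma succ_min_ratio_ge: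
  fixes L1 L2 :: "(real ^ 'n) set"
  assumes "1 \<le> i" "i \<le> CARD('n)"
  shows "succ_min i L2 / succ_min i L1 \<le> succ_min_ratio L1 L2"
  unfolding succ_min_ratio_def using assms by (intro Max_ge) auto

lemma succ_min_ratio_le:
  fixes L1 L2 :: "(real ^ 'n) set"
  assumes "\<And>i. 1 \<le> i \<Longrightarrow> i \<le> CARD('n) \<Longrightarrow> succ_min i L2 / succ_min i L1 \<le> c"
  shows "succ_min_ratio L1 L2 \<le> c"
  unfolding succ_min_ratio_def
  using assms by (subst Max_le_iff) (auto simp: Suc_le_eq)

lemma succ_min_ratio_pos:
  fixes L1 L2 :: "(real ^ 'n) set"
  assumes "full_rank_lattice L1" "full_rank_lattice L2"
  shows "succ_min_ratio L1 L2 > 0"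
proof -
  have "(1::nat) \<le> CARD('n)" by (simp add: Suc_le_eq)
  then have "0 < succ_min 1 L2 / succ_min 1 L1"
    using assms succ_min_attained(1) by (metis divide_pos_pos order_refl)
  also have "\<dots> \<le> succ_min_ratio L1 L2"
    using \<open>1 \<le> CARD('n)\<close> by (intro succ_min_ratio_ge) auto
  finally show ?thesis .
qed

section \<open>Sorted bases\<close>

lemma seysen_ge:
  "norm (column i B) * norm (column i (dual_basis B)) \<le> seysen B"
  unfolding seysen_def by (intro Max_ge) auto

lemma seysen_pos:
  assumes "lattice_basis B L"
  shows "seysen B > 0"
  using mult_pos_pos[OF column_norm_pos[OF assms] dual_column_norm_pos[OF assms]]
    seysen_ge less_le_trans by blast

text \<open>\<open>card {..i}\<close> is the one-based rank of \<open>i\<close>. The columns up to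
  \<open>i\<close> are that many independent lattice vectors, and sorting makes column
  \<open>i\<close> the longest of them.\<close>

lemma succ_min_le_column_norm:
  fixes B :: "real ^ 'n::{finite,linorder} ^ 'n::{finite,linorder}"
  assumes "lattice_basis B L" "sorted_columns B"
  shows "succ_min (card {..i}) L \<le> norm (column i B)"
proof -
  let ?V = "(\<lambda>j. column j B) ` {..i}"
  have "inj (\<lambda>j. column j B)" "independent (columns B)"
    using assms by (auto simp: lattice_basis_def)
  moreover have "?V \<subseteq> columns B" by (auto simp: columns_def)
  ultimately have V: "card ?V = card {..i}" "independent ?V"
    using card_image[OF inj_on_subset] independent_mono by blast+
  show ?thesis
  proof (rule succ_min_attained(3))
    show "full_rank_lattice L" using assms by (auto simp: full_rank_lattice_def)
    show "1 \<le> card {..i}" by (auto simp: Suc_le_eq card_gt_0_iff)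
    show "card {..i} \<le> CARD('n)" by (intro card_mono) auto
    show "?V \<subseteq> L" using lattice_basis_column_mem[OF assms(1)] by auto
    show "norm v \<le> norm (column i B)" if "v \<in> ?V" for v
      using that assms(2) by (auto simp: sorted_columns_def mono_def)
  qed (use V in auto)
qed

text \<open>Among \<open>k\<close> independent lattice vectors of length at most \<open>\<lambda>\<^sub>k\<close>, one lies outside
  the span of the first \<open>k - 1\<close> basis vectors, so it pairs to a nonzero integer with some
  dual vector of index at least \<open>k\<close>.\<close>

lemma column_norm_le_seysen_succ_min:
  fixes B :: "real ^ 'n::{finite,linorder} ^ 'n::{finite,linorder}"
  assumes B: "lattice_basis B L" and sorted: "sorted_columns B"
  shows "norm (column i B) \<le> seysen B * succ_min (card {..i}) L"
proof -
  let ?d = "\<lambda>j. column j (dual_basis B)"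
  define l where "l = succ_min (card {..i}) L"
  have k: "1 \<le> card {..i}" "card {..i} \<le> CARD('n)"
    by (auto simp: Suc_le_eq card_gt_0_iff intro: card_mono)
  have L: "full_rank_lattice L" using B by (auto simp: full_rank_lattice_def)
  have "l > 0" using succ_min_attained(1)[OF L k] by (simp add: l_def)
  obtain V where V: "V \<subseteq> L" "independent V" "card V = card {..i}" "\<forall>v\<in>V. norm v \<le> l"
    using succ_min_attained(2)[OF L k] unfolding l_def by blast
  have "\<exists>v\<in>V. \<exists>j\<ge>i. ?d j \<bullet> v \<noteq> 0"
  proof (rule ccontr)
    assume "\<not> ?thesis"
    then have zero: "?d j \<bullet> v = 0" if "v \<in> V" "j \<ge> i" for v j using that by blast
    let ?W = "(\<lambda>j. column j B) ` {..<i}"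
    have "v \<in> span ?W" if "v \<in> V" for v
    proof -
      have "(?d j \<bullet> v) *\<^sub>R column j B \<in> span ?W" for j
      proof (cases "j < i")
        case True
        then show ?thesis by (intro span_scale span_base) auto
      next
        case False
        then have "?d j \<bullet> v = 0" using zero that by simp
        then show ?thesis by (simp add: span_zero)
      qed
      then have "(\<Sum>j\<in>UNIV. (?d j \<bullet> v) *\<^sub>R column j B) \<in> span ?W" by (intro span_sum)
      then show ?thesis
        using dual_basis_expansion[OF lattice_basis_invertible[OF B], of v] by simp
    qed
    then have "card V \<le> card ?W"
      using V(2) independent_span_bound[of ?W V] by auto
    also have "\<dots> \<le> card {..<i}" by (rule card_image_le) simp
    also have "\<dots> < card {..i}" by (intro psubset_card_mono) auto
    finally show False using V(3) by simp
  qed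
  then obtain v j where vj: "v \<in> V" "i \<le> j" "?d j \<bullet> v \<noteq> 0" by blast
  have "1 \<le> norm (?d j) * norm v"
    using dual_basis_norm_mult_ge_1[OF B] vj V(1) by blast
  also have "\<dots> \<le> norm (?d j) * l" using V(4) vj by (intro mult_left_mono) auto
  \<comment> \<open>Multiplying by the length of column \<open>j\<close> completes the product
    bounded by \<open>seysen B\<close>; sorting then passes from column \<open>j\<close> to the no
    longer column \<open>i\<close>.\<close>
  finally have "norm (column j B) * 1 \<le> norm (column j B) * (norm (?d j) * l)"
    by (intro mult_left_mono) auto
  also have "\<dots> \<le> seysen B * l"
    using mult_right_mono[OF seysen_ge[of j B], of l] \<open>l > 0\<close>
    by (simp add: mult.assoc)
  finally have "norm (column j B) \<le> seysen B * l" by simp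
  moreover have "norm (column i B) \<le> norm (column j B)"
    using sorted vj(2) by (auto simp: sorted_columns_def mono_def)
  ultimately show ?thesis by (simp add: l_def)
qed

text \<open>With \<open>k\<close> the rank of \<open>i\<close>, the dual vector has length at most
  \<open>seysen B1\<close> over \<lambda>_k of \<open>L1\<close>, and column \<open>i\<close> of
  \<open>B2\<close> has length at most \<open>seysen B2\<close> times \<lambda>_k of
  \<open>L2\<close>. The factor \<open>CARD('n)\<close> counts the rank-one summands in the triangle
  inequality.\<close>

lemma onorm_base_change_le:
  fixes B1 B2 :: "real ^ 'n::{finite,linorder} ^ 'n::{finite,linorder}"
  assumes B1: "lattice_basis B1 L1" "sorted_columns B1"
    and B2: "lattice_basis B2 L2" "sorted_columns B2"
  shows "onorm ((*v) (B2 ** matrix_inv B1))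
           \<le> real CARD('n) * seysen B1 * seysen B2 * succ_min_ratio L1 L2"
proof (rule onorm_le)
  fix x
  let ?d = "\<lambda>i. column i (dual_basis B1)"
  let ?C = "seysen B1 * seysen B2 * succ_min_ratio L1 L2"
  have summand: "norm (?d i) * norm (column i B2) \<le> ?C" for i
  proof -
    let ?k = "card {..i}"
    have k: "1 \<le> ?k" "?k \<le> CARD('n)"
      by (auto simp: Suc_le_eq card_gt_0_iff intro: card_mono)
    have L: "full_rank_lattice L1" "full_rank_lattice L2"
      using B1 B2 by (auto simp: full_rank_lattice_def)
    note l1 = succ_min_attained(1)[OF L(1) k] and l2 = succ_min_attained(1)[OF L(2) k]
    have "norm (?d i) * succ_min ?k L1 \<le> norm (?d i) * norm (column i B1)"
      using succ_min_le_column_norm[OF B1] by (intro mult_left_mono) auto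
    also have "\<dots> \<le> seysen B1" using seysen_ge[of i B1] by (simp add: mult.commute)
    finally have "norm (?d i) \<le> seysen B1 / succ_min ?k L1" using l1 by (simp add: field_simps)
    then have "norm (?d i) * norm (column i B2)
        \<le> (seysen B1 / succ_min ?k L1) * (seysen B2 * succ_min ?k L2)"
      using column_norm_le_seysen_succ_min[OF B2] seysen_pos[OF B1(1)] l1
      by (intro mult_mono) auto
    also have "\<dots> = seysen B1 * seysen B2 * (succ_min ?k L2 / succ_min ?k L1)" by simp
    also have "\<dots> \<le> ?C"
      using succ_min_ratio_ge[OF k] seysen_pos[OF B1(1)]
        seysen_pos[OF B2(1)]
      by (intro mult_left_mono) auto
    finally show ?thesis .
  qed
  have "norm ((B2 ** matrix_inv B1) *v x) \<le> (\<Sum>i\<in>UNIV. norm ((?d i \<bullet> x) *\<^sub>R column i B2))"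
    unfolding base_change_expansion by (rule norm_sum)
  also have "\<dots> \<le> (\<Sum>i\<in>(UNIV :: 'n set). ?C * norm x)"
  proof (rule sum_mono)
    fix i :: 'n
    have "norm ((?d i \<bullet> x) *\<^sub>R column i B2) \<le> (norm (?d i) * norm x) * norm (column i B2)"
      unfolding norm_scaleR by (intro mult_right_mono Cauchy_Schwarz_ineq2) auto
    also have "\<dots> = (norm (?d i) * norm (column i B2)) * norm x" by simp
    also have "\<dots> \<le> ?C * norm x" by (intro mult_right_mono summand) auto
    finally show "norm ((?d i \<bullet> x) *\<^sub>R column i B2) \<le> ?C * norm x" .
  qed
  finally show "norm ((B2 ** matrix_inv B1) *v x)
      \<le> real CARD('n) * seysen B1 * seysen B2 * succ_min_ratio L1 L2 * norm x"
    by (simp add: mult.assoc)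
qed

section \<open>Linear maps between lattices\<close>

lemma span_full_rank_lattice:
  assumes "full_rank_lattice L"
  shows "span L = UNIV"
proof -
  obtain B where B: "lattice_basis B L"
    using assms by (auto simp: full_rank_lattice_def)
  have "x \<in> span L" for x
  proof -
    have "(\<Sum>i\<in>UNIV. (column i (dual_basis B) \<bullet> x) *\<^sub>R column i B) \<in> span L"
      by (intro span_sum span_scale span_base lattice_basis_column_mem[OF B])
    then show ?thesis
      using dual_basis_expansion[OF lattice_basis_invertible[OF B], of x] by simp
  qed
  then show ?thesis by blast
qed

text \<open>The range contains the spanning set \<open>L2\<close>, so \<open>T\<close> is
  surjective, and equality of dimensions makes it injective.\<close>

lemma lattice_map_bij:
  fixes T :: "real ^ 'n \<Rightarrow> real ^ 'n"
  assumes "linear T" "T ` L1 = L2" "full_rank_lattice L2"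
  shows "bij T"
proof -
  have "UNIV \<subseteq> range T"
    using assms span_full_rank_lattice[OF assms(3)] linear_span_image[OF assms(1), of L1]
    by (metis image_mono subset_UNIV)
  then have "surj T" by auto
  then show ?thesis using linear_surjective_imp_injective[OF assms(1)] by (auto simp: bij_def)
qed

lemma lattice_map_inv:
  fixes T :: "real ^ 'n \<Rightarrow> real ^ 'n"
  assumes "linear T" "T ` L1 = L2" "full_rank_lattice L2"
  shows "linear (inv T)" "inv T ` L2 = L1"
proof -
  have bij: "bij T" using lattice_map_bij[OF assms] .
  then have "inj T" by (simp add: bij_def)
  show "linear (inv T)"
    using bij assms(1) inj_linear_imp_inv_linear bij_is_inj by blast
  show "inv T ` L2 = L1"
    using assms(2) image_inv_f_f[OF \<open>inj T\<close>] by blast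
qed

text \<open>Apply \<open>T\<close> to a family realising the \<open>i\<close>-th minimum of
  \<open>L1\<close>: injectivity preserves independence and cardinality, and lengths grow by at most
  \<open>onorm T\<close>.\<close>

lemma succ_min_ratio_le_onorm:
  fixes T :: "real ^ 'n \<Rightarrow> real ^ 'n"
  assumes lin: "linear T" and img: "T ` L1 = L2"
    and L: "full_rank_lattice L1" "full_rank_lattice L2"
  shows "succ_min_ratio L1 L2 \<le> onorm T"
proof (rule succ_min_ratio_le)
  fix i :: nat assume i: "1 \<le> i" "i \<le> CARD('n)"
  have inj: "inj T" using lattice_map_bij[OF lin img L(2)] by (simp add: bij_def)
  obtain V where V: "V \<subseteq> L1" "independent V" "card V = i" "\<forall>v\<in>V. norm v \<le> succ_min i L1"
    using succ_min_attained(2)[OF L(1) i] by blast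
  have "succ_min i L2 \<le> onorm T * succ_min i L1"
  proof (rule succ_min_attained(3)[OF L(2) i])
    show "T ` V \<subseteq> L2" using V img by blast
    show "independent (T ` V)"
      using linear_independent_injective_image[OF lin V(2)] inj inj_on_subset by blast
    show "card (T ` V) = i" using V(3) inj by (simp add: card_image inj_on_subset)
    fix w assume "w \<in> T ` V"
    then obtain v where v: "v \<in> V" "w = T v" by blast
    have bl: "bounded_linear T" using lin linear_conv_bounded_linear by blast
    have "norm (T v) \<le> onorm T * norm v" by (rule onorm[OF bl])
    also have "\<dots> \<le> onorm T * succ_min i L1"
      using v V(4) by (intro mult_left_mono onorm_pos_le[OF bl]) auto
    finally show "norm w \<le> onorm T * succ_min i L1" using v by simp
  qed
  then show "succ_min i L2 / succ_min i L1 \<le> onorm T"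
    using succ_min_attained(1)[OF L(1) i] by (simp add: field_simps)
qed

lemma succ_min_ratios_le_cond_num:
  fixes T :: "real ^ 'n \<Rightarrow> real ^ 'n"
  assumes "linear T" "T ` L1 = L2" "full_rank_lattice L1" "full_rank_lattice L2"
  shows "succ_min_ratio L1 L2 * succ_min_ratio L2 L1 \<le> cond_num T"
proof -
  note inv = lattice_map_inv[OF assms(1,2,4)]
  show ?thesis
    unfolding cond_num_def
    using succ_min_ratio_le_onorm[OF assms] succ_min_ratio_le_onorm[OF inv assms(4,3)]
      succ_min_ratio_pos[OF assms(3,4)] succ_min_ratio_pos[OF assms(4,3)]
    by (intro mult_mono) auto
qed

text \<open>The matrix sends each column of \<open>B1\<close> to the same column of
  \<open>B2\<close>, so integer combinations go to integer combinations with the same coefficients.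
  Swapping the bases gives the inverse.\<close>

lemma base_change_lattice:
  fixes B1 B2 :: "real ^ 'n ^ 'n"
  assumes "lattice_basis B1 L1" "lattice_basis B2 L2"
  shows "(*v) (B2 ** matrix_inv B1) ` L1 = L2"
    and "inv ((*v) (B2 ** matrix_inv B1)) = (*v) (B1 ** matrix_inv B2)"
proof -
  let ?T = "(*v) (B2 ** matrix_inv B1)"
  note inv1 = lattice_basis_invertible[OF assms(1)] and inv2 = lattice_basis_invertible[OF assms(2)]
  have col: "?T (column j B1) = column j B2" for j
    unfolding base_change_expansion dual_basis_inner[OF inv1]
    by (simp add: if_distrib[of "\<lambda>c. c *\<^sub>R _"] cong: if_cong)
  have "?T (\<Sum>i\<in>UNIV. of_int (z i) *\<^sub>R column i B1) = (\<Sum>i\<in>UNIV. of_int (z i) *\<^sub>R column i B2)"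
    for z :: "'n \<Rightarrow> int"
    by (simp only: linear_sum[OF matrix_vector_mul_linear] linear_cmul[OF matrix_vector_mul_linear] col)
  then show "?T ` L1 = L2"
    using assms by (simp add: lattice_basis_def image_image)
  have cancel: "(A ** matrix_inv C) ** (C ** matrix_inv A) = mat 1"
    if "invertible A" "invertible C" for A C :: "real ^ 'n ^ 'n"
    by (metis matrix_inv_mult_left matrix_inv_mult_right matrix_mul_assoc matrix_mul_lid that)
  show "inv ?T = (*v) (B1 ** matrix_inv B2)"
    by (rule inv_unique_comp)
      (simp_all only: fun_eq_iff o_apply id_apply matrix_vector_mul_assoc
        cancel[OF inv1 inv2] cancel[OF inv2 inv1] matrix_vector_mul_lid simp_thms)
qed

text \<open>The inverse is again a base change, with the roles of the bases exchanged, so the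
  operator norm bound applies to both factors; this squares the dimension and the two Seysen
  numbers.\<close>

lemma cond_num_base_change_le:
  fixes B1 B2 :: "real ^ 'n::{finite,linorder} ^ 'n::{finite,linorder}"
  assumes B1: "lattice_basis B1 L1" "sorted_columns B1"
    and B2: "lattice_basis B2 L2" "sorted_columns B2"
  shows "cond_num ((*v) (B2 ** matrix_inv B1))
           \<le> (real CARD('n))\<^sup>2 * (seysen B1)\<^sup>2 * (seysen B2)\<^sup>2 *
             (succ_min_ratio L1 L2 * succ_min_ratio L2 L1)"
proof -
  let ?n = "real CARD('n)"
  have L: "full_rank_lattice L1" "full_rank_lattice L2"
    using B1 B2 by (auto simp: full_rank_lattice_def)
  have "cond_num ((*v) (B2 ** matrix_inv B1))
      = onorm ((*v) (B2 ** matrix_inv B1)) * onorm ((*v) (B1 ** matrix_inv B2))"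
    unfolding cond_num_def base_change_lattice(2)[OF B1(1) B2(1)] ..
  also have "\<dots> \<le> (?n * seysen B1 * seysen B2 * succ_min_ratio L1 L2)
      * (?n * seysen B2 * seysen B1 * succ_min_ratio L2 L1)"
    using seysen_pos[OF B1(1)] seysen_pos[OF B2(1)]
      succ_min_ratio_pos[OF L]
    by (intro mult_mono onorm_base_change_le[OF B1 B2] onorm_base_change_le[OF B2 B1]
        onorm_pos_le matrix_vector_mul_bounded_linear) auto
  also have "\<dots> = ?n\<^sup>2 * (seysen B1)\<^sup>2 * (seysen B2)\<^sup>2 * (succ_min_ratio L1 L2 * succ_min_ratio L2 L1)"
    by (simp add: power2_eq_square mult_ac)
  finally show ?thesis .
qed

section \<open>Attainment of Seysen's condition number and of the distance\<close>

text \<open>Only finitely many bases have Seysen number at most that of a fixed basis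
  \<open>B\<close>, because their columns all lie in one ball.\<close>

lemma lattice_seysen_attained:
  fixes L :: "(real ^ 'n) set"
  assumes "full_rank_lattice L"
  shows "\<exists>B. lattice_basis B L \<and> seysen B = lattice_seysen L"
proof -
  obtain B where B: "lattice_basis B L"
    using assms by (auto simp: full_rank_lattice_def)
  define N where "N = (\<Sum>j\<in>UNIV. norm (column j B))"
  have N: "norm (column j B) \<le> N" for j
    unfolding N_def by (rule member_le_sum) auto
  let ?F = "{x \<in> L. norm x \<le> seysen B * N}"
  have bound: "column i C \<in> ?F" if C: "lattice_basis C L" "seysen C \<le> seysen B" for C i
  proof -
    let ?d = "column i (dual_basis C)"
    \<comment> \<open>Expand \<open>?d\<close> in the basis \<open>B\<close> and pair with
      \<open>?d\<close> itself: the result is nonzero, so some summand is. This gives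
      \<open>1 \<le> norm ?d * N\<close> with \<open>N\<close> independent of
      \<open>C\<close>.\<close>
    obtain j where "?d \<bullet> column j B \<noteq> 0"
    proof -
      have "?d \<bullet> ?d \<noteq> 0" using dual_column_norm_pos[OF C(1), of i] by simp
      then have "(\<Sum>j\<in>UNIV. (column j (dual_basis B) \<bullet> ?d) * (?d \<bullet> column j B)) \<noteq> 0"
        using arg_cong[OF dual_basis_expansion[OF lattice_basis_invertible[OF B], of ?d],
            of "\<lambda>y. ?d \<bullet> y"]
        by (simp add: inner_sum_right)
      then show ?thesis using that by (metis (no_types, lifting) mult_zero_right sum.neutral)
    qed
    then have "1 \<le> norm ?d * norm (column j B)"
      using dual_basis_norm_mult_ge_1[OF C(1) lattice_basis_column_mem[OF B]] by blast
    also have "\<dots> \<le> norm ?d * N" by (intro mult_left_mono N) auto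
    finally have "norm (column i C) * 1 \<le> norm (column i C) * (norm ?d * N)"
      by (intro mult_left_mono) auto
    also have "\<dots> = norm (column i C) * norm ?d * N" by simp
    also have "\<dots> \<le> seysen B * N"
      using seysen_ge[of i C] C(2) order_trans[OF norm_ge_zero N]
      by (intro mult_right_mono) auto
    finally show ?thesis using lattice_basis_column_mem[OF C(1)] by simp
  qed
  have "finite ((\<lambda>f. seysen (\<chi> r c. f c $ r)) ` (PiE (UNIV :: 'n set) (\<lambda>_. ?F)))"
    by (intro finite_imageI finite_PiE finite_lattice_norm_le[OF B]) auto
  moreover have "{s. (\<exists>C. lattice_basis C L \<and> s = seysen C) \<and> s \<le> seysen B}
      \<subseteq> (\<lambda>f. seysen (\<chi> r c. f c $ r)) ` (PiE (UNIV :: 'n set) (\<lambda>_. ?F))"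
  proof clarify
    fix C assume C: "lattice_basis C L" "seysen C \<le> seysen B"
    have "C = (\<chi> r c. column c C $ r)" by (simp add: column_def vec_eq_iff)
    then show "seysen C \<in> (\<lambda>f. seysen (\<chi> r c. f c $ r)) ` (PiE (UNIV :: 'n set) (\<lambda>_. ?F))"
      using bound[OF C] by (intro image_eqI[of _ _ "\<lambda>i. column i C"]) auto
  qed
  ultimately have "finite {s. (\<exists>C. lattice_basis C L \<and> s = seysen C) \<and> s \<le> seysen B}"
    using finite_subset by blast
  from Least_attained_if_finite_below(1)[OF _ this] show ?thesis
    using B unfolding lattice_seysen_def[symmetric] by metis
qed

text \<open>Permuting the columns keeps the lattice and permutes the dual basis in the same way, so
  the maximum runs over the same products.\<close>

lemma lattice_seysen_attained_sorted:
  fixes L :: "(real ^ 'n::{finite,linorder}) set"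
  assumes "full_rank_lattice L"
  shows "\<exists>B. lattice_basis B L \<and> sorted_columns B \<and> seysen B = lattice_seysen L"
proof -
  obtain B where B: "lattice_basis B L" "seysen B = lattice_seysen L"
    using lattice_seysen_attained[OF assms] by blast
  obtain p :: "'n \<Rightarrow> 'n" where p: "bij p" "mono (\<lambda>i. norm (column (p i) B))"
    using ex_sorting_permutation[of "\<lambda>i. norm (column i B)"] by blast
  have rp: "range p = UNIV" using p(1) by (simp add: bij_def)
  define C where "C = (\<chi> r c. B $ r $ p c)"
  have col: "column i C = column (p i) B" for i by (simp add: C_def column_def)
  have "columns C = columns B"
    unfolding columns_def using col rp by (auto simp: image_iff) (metis rangeE UNIV_I)
  moreover have "inj (\<lambda>i. column i C)"
    unfolding col using inj_compose[of "\<lambda>i. column i B" p] B(1) p(1)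
    by (simp add: lattice_basis_def bij_def o_def)
  moreover have "L = range (\<lambda>z :: 'n \<Rightarrow> int. \<Sum>i\<in>UNIV. of_int (z i) *\<^sub>R column i C)"
  proof -
    \<comment> \<open>Permuting the coefficients along with the columns leaves the vector unchanged;
      \<open>p\<close> gives one inclusion of the ranges and its inverse the other.\<close>
    have re: "(\<Sum>i\<in>UNIV. of_int (z (p i)) *\<^sub>R column i C) = (\<Sum>i\<in>UNIV. of_int (z i) *\<^sub>R column i B)"
      for z :: "'n \<Rightarrow> int"
      unfolding col using sum.reindex_bij_betw[OF p(1), of "\<lambda>i. of_int (z i) *\<^sub>R column i B"] by simp
    have "(\<Sum>i\<in>UNIV. of_int (z i) *\<^sub>R column i C)
        = (\<Sum>i\<in>UNIV. of_int (z (inv p i)) *\<^sub>R column i B)" for z :: "'n \<Rightarrow> int"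
      using re[of "\<lambda>i. z (inv p i)"] p(1) by (simp add: bij_def)
    then have "range (\<lambda>z :: 'n \<Rightarrow> int. \<Sum>i\<in>UNIV. of_int (z i) *\<^sub>R column i C)
        \<subseteq> range (\<lambda>z :: 'n \<Rightarrow> int. \<Sum>i\<in>UNIV. of_int (z i) *\<^sub>R column i B)"
      by (simp only:) (intro image_subsetI rangeI)
    moreover have "range (\<lambda>z :: 'n \<Rightarrow> int. \<Sum>i\<in>UNIV. of_int (z i) *\<^sub>R column i B)
        \<subseteq> range (\<lambda>z :: 'n \<Rightarrow> int. \<Sum>i\<in>UNIV. of_int (z i) *\<^sub>R column i C)"
      by (simp only: re[symmetric]) (intro image_subsetI rangeI)
    ultimately show ?thesis using B(1) by (simp add: lattice_basis_def)
  qed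
  ultimately have C: "lattice_basis C L" using B(1) by (simp add: lattice_basis_def)
  have "matrix_inv C = (\<chi> r c. matrix_inv B $ p r $ c)"
  proof (rule matrix_inv_eqI)
    have "(C ** (\<chi> r c. matrix_inv B $ p r $ c)) $ r $ c = (B ** matrix_inv B) $ r $ c" for r c
      using sum.reindex_bij_betw[OF p(1), of "\<lambda>k. B $ r $ k * matrix_inv B $ k $ c"]
      by (simp add: matrix_matrix_mult_def C_def)
    then show "C ** (\<chi> r c. matrix_inv B $ p r $ c) = mat 1"
      using matrix_inv_mult_right[OF lattice_basis_invertible[OF B(1)]] by (simp add: vec_eq_iff)
  qed
  then have dual: "column i (dual_basis C) = column (p i) (dual_basis B)" for i
    by (simp add: column_dual_basis row_def)
  have "seysen C = seysen B"
  proof -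
    have "range (\<lambda>i. norm (column (p i) B) * norm (column (p i) (dual_basis B)))
        = (\<lambda>i. norm (column i B) * norm (column i (dual_basis B))) ` range p"
      by (simp add: image_image)
    then show ?thesis unfolding seysen_def col dual rp by simp
  qed
  moreover have "sorted_columns C" using p(2) by (simp add: sorted_columns_def col)
  ultimately show ?thesis using C B(2) by metis
qed

text \<open>A map with condition number at most that of the base change \<open>T0\<close> sends the
  basis of \<open>L1\<close> into a fixed ball of \<open>L2\<close>. It is determined by these
  images, so finitely many such maps exist.\<close>

lemma lattice_dist_attained:
  fixes L1 L2 :: "(real ^ 'n) set"
  assumes L: "full_rank_lattice L1" "full_rank_lattice L2"
  shows "\<exists>T. linear T \<and> T ` L1 = L2 \<and> lattice_dist L1 L2 = cond_num T"
    and "\<And>T. linear T \<Longrightarrow> T ` L1 = L2 \<Longrightarrow> lattice_dist L1 L2 \<le> cond_num T"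
proof -
  obtain B1 B2 where B: "lattice_basis B1 L1" "lattice_basis B2 L2"
    using L by (auto simp: full_rank_lattice_def)
  obtain \<delta> where \<delta>: "\<delta> > 0" "\<And>x. x \<in> L1 \<Longrightarrow> x \<noteq> 0 \<Longrightarrow> \<delta> \<le> norm x"
    using lattice_nonzero_norm_ge[OF B(1)] by blast
  \<comment> \<open>Any fixed nonzero vector of \<open>L2\<close> would do; \<open>undefined\<close>
    merely picks some index.\<close>
  define y where "y = column undefined B2"
  have y: "y \<in> L2" "norm y > 0"
    using lattice_basis_column_mem[OF B(2)] column_norm_pos[OF B(2)] by (simp_all add: y_def)
  define N where "N = (\<Sum>j\<in>UNIV. norm (column j B1))"
  have N: "norm (column j B1) \<le> N" for j
    unfolding N_def by (rule member_le_sum) auto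
  define P where "P k \<longleftrightarrow> (\<exists>T. linear T \<and> T ` L1 = L2 \<and> k = cond_num T)" for k
  define T0 where "T0 = (*v) (B2 ** matrix_inv B1)"
  define R where "R = cond_num T0 * norm y / \<delta> * N"
  let ?F = "{x \<in> L2. norm x \<le> R}"
  \<comment> \<open>The inner function is the linear map taking column \<open>i\<close> of
    \<open>B1\<close> to \<open>f i\<close>.\<close>
  let ?G = "\<lambda>f. cond_num (\<lambda>x. \<Sum>i\<in>UNIV. (column i (dual_basis B1) \<bullet> x) *\<^sub>R f i)"
  have P0: "P (cond_num T0)"
    unfolding P_def T0_def using base_change_lattice(1)[OF B] by blast
  have bound: "T (column j B1) \<in> ?F"
    if T: "linear T" "T ` L1 = L2" "cond_num T \<le> cond_num T0" for T j
  proof -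
    note inv = lattice_map_inv[OF T(1,2) L(2)]
    have bl: "bounded_linear T" "bounded_linear (inv T)"
      using T(1) inv(1) linear_conv_bounded_linear by blast+
    have "T (inv T y) = y"
      using lattice_map_bij[OF T(1,2) L(2)] by (simp add: bij_def surj_f_inv_f)
    then have "inv T y \<noteq> 0" using y linear_0[OF T(1)] by auto
    then have "\<delta> \<le> norm (inv T y)" using \<delta>(2) inv(2) y(1) by blast
    also have "\<dots> \<le> onorm (inv T) * norm y" by (rule onorm[OF bl(2)])
    \<comment> \<open>\<open>inv T y\<close> is a nonzero vector of \<open>L1\<close>, so
      \<open>inv T\<close> cannot shrink \<open>y\<close> below \<open>\<delta>\<close>. Multiplying
      by \<open>onorm T\<close> turns this lower bound on the inverse, through the condition number,
      into an upper bound on \<open>onorm T\<close>.\<close>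
    finally have "onorm T * \<delta> \<le> onorm T * (onorm (inv T) * norm y)"
      by (intro mult_left_mono onorm_pos_le[OF bl(1)])
    also have "\<dots> = cond_num T * norm y" by (simp add: cond_num_def)
    also have "\<dots> \<le> cond_num T0 * norm y" using T(3) by (intro mult_right_mono) auto
    finally have on: "onorm T \<le> cond_num T0 * norm y / \<delta>" using \<delta>(1) by (simp add: field_simps)
    have "norm (T (column j B1)) \<le> onorm T * norm (column j B1)" by (rule onorm[OF bl(1)])
    also have "\<dots> \<le> R"
      unfolding R_def using on N order_trans[OF onorm_pos_le[OF bl(1)] on]
      by (intro mult_mono) auto
    finally show ?thesis using lattice_basis_column_mem[OF B(1)] T(2) by blast
  qed
  have "finite (?G ` (PiE (UNIV :: 'n set) (\<lambda>_. ?F)))"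
    by (intro finite_imageI finite_PiE finite_lattice_norm_le[OF B(2)]) auto
  moreover have "{k. P k \<and> k \<le> cond_num T0} \<subseteq> ?G ` (PiE (UNIV :: 'n set) (\<lambda>_. ?F))"
  proof
    fix k assume "k \<in> {k. P k \<and> k \<le> cond_num T0}"
    then obtain T where T: "linear T" "T ` L1 = L2" "cond_num T \<le> cond_num T0" "k = cond_num T"
      by (auto simp: P_def)
    have "T = (\<lambda>x. \<Sum>i\<in>UNIV. (column i (dual_basis B1) \<bullet> x) *\<^sub>R T (column i B1))"
    proof
      fix x
      show "T x = (\<Sum>i\<in>UNIV. (column i (dual_basis B1) \<bullet> x) *\<^sub>R T (column i B1))"
        by (subst dual_basis_expansion[OF lattice_basis_invertible[OF B(1)], of x])
          (simp only: linear_sum[OF T(1)] linear_cmul[OF T(1)])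
    qed
    from T(4) arg_cong[OF this, of cond_num] have "k = ?G (\<lambda>i. T (column i B1))" by (rule trans)
    then show "k \<in> ?G ` (PiE (UNIV :: 'n set) (\<lambda>_. ?F))"
      using bound[OF T(1-3)] by (intro image_eqI[of _ _ "\<lambda>i. T (column i B1)"]) auto
  qed
  ultimately have "finite {k. P k \<and> k \<le> cond_num T0}" using finite_subset by blast
  note m = Least_attained_if_finite_below[of P, OF P0 this]
  have eq: "lattice_dist L1 L2 = Least P" unfolding lattice_dist_def P_def[abs_def] ..
  show "\<exists>T. linear T \<and> T ` L1 = L2 \<and> lattice_dist L1 L2 = cond_num T"
    using m(1) unfolding eq P_def[of "Least P"] .
  show "lattice_dist L1 L2 \<le> cond_num T" if "linear T" "T ` L1 = L2" for T
    unfolding eq by (rule m(2)) (use that in \<open>auto simp: P_def\<close>)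
qed

theorem theorem1p2:
  fixes L1 L2 :: "(real ^ 'n::{finite,linorder}) set"
  assumes "full_rank_lattice L1" and "full_rank_lattice L2"
  shows "(\<forall>B1 B2. lattice_basis B1 L1 \<and> lattice_basis B2 L2 \<and>
             sorted_columns B1 \<and> sorted_columns B2 \<longrightarrow>
           succ_min_ratio L1 L2 * succ_min_ratio L2 L1
             \<le> cond_num ((*v) (B2 ** matrix_inv B1)) \<and>
           cond_num ((*v) (B2 ** matrix_inv B1))
             \<le> (real CARD('n))\<^sup>2 * (seysen B1)\<^sup>2 * (seysen B2)\<^sup>2 *
                (succ_min_ratio L1 L2 * succ_min_ratio L2 L1)) \<and>
         succ_min_ratio L1 L2 * succ_min_ratio L2 L1 \<le> lattice_dist L1 L2 \<and>
         lattice_dist L1 L2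
           \<le> (real CARD('n))\<^sup>2 * (lattice_seysen L1)\<^sup>2 * (lattice_seysen L2)\<^sup>2 *
              (succ_min_ratio L1 L2 * succ_min_ratio L2 L1)"
proof (intro conjI allI impI; (elim conjE)?)
  fix B1 B2
  assume B: "lattice_basis B1 L1" "lattice_basis B2 L2" "sorted_columns B1" "sorted_columns B2"
  show "succ_min_ratio L1 L2 * succ_min_ratio L2 L1 \<le> cond_num ((*v) (B2 ** matrix_inv B1))"
    by (rule succ_min_ratios_le_cond_num[OF matrix_vector_mul_linear
          base_change_lattice(1)[OF B(1,2)] assms])
  show "cond_num ((*v) (B2 ** matrix_inv B1))
      \<le> (real CARD('n))\<^sup>2 * (seysen B1)\<^sup>2 * (seysen B2)\<^sup>2 *
        (succ_min_ratio L1 L2 * succ_min_ratio L2 L1)"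
    by (rule cond_num_base_change_le[OF B(1,3,2,4)])
next
  show "succ_min_ratio L1 L2 * succ_min_ratio L2 L1 \<le> lattice_dist L1 L2"
    using lattice_dist_attained(1)[OF assms] succ_min_ratios_le_cond_num[OF _ _ assms] by metis
next
  \<comment> \<open>Sorted bases attaining both lattice Seysen numbers give a base change that
    competes in the distance and obeys the bound for bases.\<close>
  obtain B1 B2 where B1: "lattice_basis B1 L1" "sorted_columns B1" "seysen B1 = lattice_seysen L1"
    and B2: "lattice_basis B2 L2" "sorted_columns B2" "seysen B2 = lattice_seysen L2"
    using lattice_seysen_attained_sorted assms by meson
  have "lattice_dist L1 L2 \<le> cond_num ((*v) (B2 ** matrix_inv B1))"
    by (rule lattice_dist_attained(2)[OF assms matrix_vector_mul_linear
          base_change_lattice(1)[OF B1(1) B2(1)]])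
  also have "\<dots> \<le> (real CARD('n))\<^sup>2 * (lattice_seysen L1)\<^sup>2 * (lattice_seysen L2)\<^sup>2 *
      (succ_min_ratio L1 L2 * succ_min_ratio L2 L1)"
    using cond_num_base_change_le[OF B1(1,2) B2(1,2)] B1(3) B2(3) by simp
  finally show "lattice_dist L1 L2
      \<le> (real CARD('n))\<^sup>2 * (lattice_seysen L1)\<^sup>2 * (lattice_seysen L2)\<^sup>2 *
        (succ_min_ratio L1 L2 * succ_min_ratio L2 L1)" .
qed

end
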